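(* Let $p$ be a prime, let $\mathcal{A}$ be a finite alphabet, let $\phi:\mathcal{A}\to\mathcal{A}^*$ be a morphism prolongable on a letter $a\in\mathcal{A}$, and let $w=\phi^\omega(a)\in\mathcal{A}^\omega$ be the resulting pure morphic word. Suppose that $w$ contains a subword of the form $uXuXu$, with $u\in\mathcal{A}$ and $X\in\mathcal{A}^*$, such that $\lim_{n\to\infty}|\phi^n(u)|=\infty$. Then for any non-erasing morphism $g:\mathcal{A}\to\{0,1,\ldots,p-1\}^*$, the real number $g(w)_p$ satisfies the $p$-adic Littlewood conjecture.
   Context: $\mathcal{A}^*$ is the set of finite words over $\mathcal{A}$, including the empty word $\epsilon$; $\mathcal{A}^\omega$ is the set of (right-)infinite words; $|v|$ is the length of a word $v$; subwords are blocks of consecutive letters. A morphism $\phi:\mathcal{A}\to\mathcal{B}^*$ is extended to words by concatenation; it is non-erasing if $\phi(c)\neq\epsilon$ for every letter $c$. Given a morphism $\phi:\mathcal{A}\to\mathcal{A}^*$, a letter $c$ is mortal if $\phi^j(c)=\epsilon$ for some $j\ge1$; $M_\phi$ is the set of mortal letters. The morphism $\phi$ is prolongable on $a\in\mathcal{A}$ if $\phi(a)=ax$ with $x\notin M_\phi^*$. In this case $a,\phi(a),\phi^2(a),\ldots$ converge to the infinite word $\phi^\omega(a)=ax\,\phi(x)\,\phi^2(x)\cdots$; words of this form are called pure morphic words. For an infinite word $v=a_1a_2\cdots$ on $\{0,1,\ldots,p-1\}$, $v_p=\sum_{n\ge1}a_np^{-n}$. A real number $x$ satisfies the $p$-adic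 Littlewood conjecture (pLC) if $\liminf_{q\to\infty} q\cdot|q|_p\cdot\|qx\|=0$, where $q$ runs over the positive integers, $|\cdot|_p$ is the $p$-adic absolute value and $\|\cdot\|$ is the distance to the nearest integer. *)

theory Defs
  imports
    "HOL-Analysis.Analysis"
    "HOL-Library.Omega_Words_Fun"
    "HOL-Computational_Algebra.Primes"
begin

section \<open>Words and morphisms\<close>

text \<open>
  A finite word is a list, an infinite word is a function \<open>nat \<Rightarrow> 'a\<close> (letters indexed
  from 0), and a morphism is given by its values on letters.
\<close>

definition extend :: "('a \<Rightarrow> 'b list) \<Rightarrow> 'a list \<Rightarrow> 'b list" where
  "extend \<phi> v = concat (map \<phi> v)"

definition non_erasing :: "('a \<Rightarrow> 'b list) \<Rightarrow> bool" where
  "non_erasing \<phi> \<longleftrightarrow> (\<forall>c. \<phi> c \<noteq> [])"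

definition mortal :: "('a \<Rightarrow> 'a list) \<Rightarrow> 'a set" where
  "mortal \<phi> = {c. \<exists>j\<ge>1. (extend \<phi> ^^ j) [c] = []}"

definition prolongable :: "('a \<Rightarrow> 'a list) \<Rightarrow> 'a \<Rightarrow> bool" where
  "prolongable \<phi> a \<longleftrightarrow> (\<exists>x. \<phi> a = a # x \<and> x \<notin> lists (mortal \<phi>))"

definition subword :: "'a list \<Rightarrow> 'a word \<Rightarrow> bool" where
  "subword v w \<longleftrightarrow> (\<exists>i j. i \<le> j \<and> v = w[i \<rightarrow> j])"

text \<open>Letterwise convergence of finite words to an infinite word.\<close>

definition converges_to :: "(nat \<Rightarrow> 'a list) \<Rightarrow> 'a word \<Rightarrow> bool" where
  "converges_to s w \<longleftrightarrow> (\<forall>i. \<forall>\<^sub>F n in sequentially. i < length (s n) \<and> s n ! i = w i)"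

definition limit_word :: "(nat \<Rightarrow> 'a list) \<Rightarrow> 'a word" where
  "limit_word s = (THE w. converges_to s w)"

definition pure_morphic_word :: "('a \<Rightarrow> 'a list) \<Rightarrow> 'a \<Rightarrow> 'a word" where
  "pure_morphic_word \<phi> a = limit_word (\<lambda>n. (extend \<phi> ^^ n) [a])"

text \<open>
  The image of an infinite word, as the limit of the images of its finite prefixes
  (meaningful only when these get arbitrarily long, e.g. for a non-erasing morphism).
\<close>

definition extend_infinite :: "('a \<Rightarrow> 'b list) \<Rightarrow> 'a word \<Rightarrow> 'b word" where
  "extend_infinite g w = limit_word (\<lambda>n. extend g (w[0 \<rightarrow> n]))"


section \<open>Expansions in base p and the p-adic Littlewood conjecture\<close>

text \<open>The letter \<open>a\<^sub>n\<close> of \<open>v = a\<^sub>1a\<^sub>2\<dots>\<close> is \<open>v (n - 1)\<close>.\<close>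

definition base_value :: "nat \<Rightarrow> nat word \<Rightarrow> real" where
  "base_value p v = (\<Sum>n. real (v n) / real p ^ Suc n)"

definition padic_abs :: "nat \<Rightarrow> nat \<Rightarrow> real" where
  "padic_abs p q = (if q = 0 then 0 else 1 / real p ^ multiplicity p q)"

definition satisfies_pLC :: "nat \<Rightarrow> real \<Rightarrow> bool" where
  "satisfies_pLC p x \<longleftrightarrow>
     liminf (\<lambda>q. ereal (real q * padic_abs p q * infdist (real q * x) \<int>)) = 0"


section \<open>The limits defining the infinite words exist\<close>

lemma converges_to_unique:
  assumes "converges_to s w" "converges_to s w'"
  shows "w = w'"
proof
  fix i
  have "\<forall>\<^sub>F n in sequentially. (i < length (s n) \<and> s n ! i = w i) \<and>
          (i < length (s n) \<and> s n ! i = w' i)"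
    using assms unfolding converges_to_def by (simp add: eventually_conj_iff)
  then obtain n where "s n ! i = w i" "s n ! i = w' i"
    unfolding eventually_sequentially by blast
  then show "w i = w' i" by simp
qed

lemma limit_word_eqI: "converges_to s w \<Longrightarrow> limit_word s = w"
  unfolding limit_word_def by (blast intro: converges_to_unique)

lemma converges_to_limit_word:
  assumes ext: "\<And>n. \<exists>ys. s (Suc n) = s n @ ys"
    and len: "\<And>n. n \<le> length (s n)"
  shows "converges_to s (limit_word s)"
proof -
  have mono: "\<exists>ys. s n = s m @ ys" if "m \<le> n" for m n
    using that
  proof (induction n rule: dec_induct)
    case (step n)
    then show ?case using ext[of n] by auto
  qed simp
  have "converges_to s (\<lambda>i. s (Suc i) ! i)"
    unfolding converges_to_def
  proof
    fix i
    have "i < length (s n) \<and> s n ! i = s (Suc i) ! i" if le: "Suc i \<le> n" for n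
    proof -
      obtain ys where "s n = s (Suc i) @ ys" using mono[OF le] by blast
      then show ?thesis using len[of "Suc i"] by (simp add: nth_append)
    qed
    then show "\<forall>\<^sub>F n in sequentially. i < length (s n) \<and> s n ! i = s (Suc i) ! i"
      unfolding eventually_sequentially by blast
  qed
  then show ?thesis using limit_word_eqI by metis
qed

lemma extend_append: "extend \<phi> (u @ v) = extend \<phi> u @ extend \<phi> v"
  by (simp add: extend_def)

lemma extend_funpow_append:
  fixes \<phi> :: "'a \<Rightarrow> 'a list"
  shows "(extend \<phi> ^^ n) (u @ v) = (extend \<phi> ^^ n) u @ (extend \<phi> ^^ n) v"
  by (induction n) (simp_all add: extend_append)

lemma pure_morphic_word_limit:
  assumes "prolongable \<phi> a"
  shows "converges_to (\<lambda>n. (extend \<phi> ^^ n) [a]) (pure_morphic_word \<phi> a)"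
proof -
  obtain x where x: "\<phi> a = a # x" "x \<notin> lists (mortal \<phi>)"
    using assms unfolding prolongable_def by blast
  have step: "(extend \<phi> ^^ Suc n) [a] = (extend \<phi> ^^ n) [a] @ (extend \<phi> ^^ n) x" for n
  proof -
    have "(extend \<phi> ^^ Suc n) [a] = (extend \<phi> ^^ n) ([a] @ x)"
      using x(1) by (simp add: funpow_Suc_right extend_def del: funpow.simps)
    then show ?thesis by (simp only: extend_funpow_append)
  qed
  obtain c where c: "c \<in> set x" "c \<notin> mortal \<phi>" using x(2) by (auto simp: in_lists_conv_set)
  have ne: "(extend \<phi> ^^ n) x \<noteq> []" for n
  proof -
    obtain y z where "x = y @ [c] @ z" using c(1) by (metis append_Cons append_Nil split_list)
    moreover have "(extend \<phi> ^^ n) [c] \<noteq> []"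
      using c(2) unfolding mortal_def by (cases n) auto
    ultimately show ?thesis by (simp only: extend_funpow_append) simp
  qed
  have "n \<le> length ((extend \<phi> ^^ n) [a])" for n
  proof (induction n)
    case (Suc n)
    have "1 \<le> length ((extend \<phi> ^^ n) x)" using ne[of n] by (cases "(extend \<phi> ^^ n) x") auto
    then show ?case using Suc step[of n] by (simp del: funpow.simps)
  qed simp
  then show ?thesis
    unfolding pure_morphic_word_def
    by (intro converges_to_limit_word) (use step in blast)+
qed

lemma extend_infinite_limit:
  assumes "non_erasing g"
  shows "converges_to (\<lambda>n. extend g (w[0 \<rightarrow> n])) (extend_infinite g w)"
proof -
  have step: "extend g (w[0 \<rightarrow> Suc n]) = extend g (w[0 \<rightarrow> n]) @ g (w n)" for n
    by (simp add: extend_def)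
  have "n \<le> length (extend g (w[0 \<rightarrow> n]))" for n
  proof (induction n)
    case (Suc n)
    have "1 \<le> length (g (w n))" using assms by (cases "g (w n)") (auto simp: non_erasing_def)
    then show ?case using Suc step[of n] by simp
  qed simp
  then show ?thesis
    unfolding extend_infinite_def
    by (intro converges_to_limit_word) (use step in blast)+
qed

end

theory Submission
  imports Defs
begin

text \<open>
  Let \<open>P\<close> be the prefix of \<open>w\<close> preceding the occurrence of \<open>uXuXu\<close>. Since \<open>\<phi>\<^sup>n\<close> followed by \<open>g\<close>
  sends prefixes of \<open>w\<close> to prefixes of \<open>v = g(w)\<close>, the word \<open>v\<close> starts with \<open>R U Y U Y U\<close>, where
  \<open>R\<close>, \<open>U\<close>, \<open>Y\<close> are the images of \<open>P\<close>, \<open>u\<close>, \<open>X\<close>. With \<open>r = |R|\<close>, \<open>s = |UY|\<close>, \<open>l = |U|\<close> and \<open>x\<close> the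
  value of \<open>v\<close>, the fractional parts of \<open>p\<^sup>r x\<close> and \<open>p\<^sup>r\<^sup>+\<^sup>s x\<close> share their first \<open>s + l\<close> digits, so
  \<open>q = p\<^sup>r (p\<^sup>s - 1)\<close> satisfies \<open>q |q|\<^sub>p \<parallel>q x\<parallel> \<le> p\<^sup>s p\<^sup>-\<^sup>s\<^sup>-\<^sup>l = p\<^sup>-\<^sup>l\<close>, and \<open>l\<close> is unbounded.
\<close>

section \<open>Prefixes of infinite words\<close>

definition initial :: "'a list \<Rightarrow> 'a word \<Rightarrow> bool" where
  "initial z w \<longleftrightarrow> (\<forall>i<length z. z ! i = w i)"

lemma initial_prefix: "initial (w[0 \<rightarrow> n]) w"
  by (simp add: initial_def)

lemma initial_eq_prefix: "initial z w \<Longrightarrow> z = w[0 \<rightarrow> length z]"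
  by (auto simp: initial_def intro: nth_equalityI)

lemma initial_appendD: "initial (y @ z) w \<Longrightarrow> initial y w"
  by (simp add: initial_def) (metis nth_append trans_less_add1)

lemma subword_initial:
  assumes "subword z w"
  obtains y where "initial (y @ z) w"
proof -
  obtain i j where "i \<le> j" "z = w[i \<rightarrow> j]"
    using assms unfolding subword_def by blast
  then have "w[0 \<rightarrow> i] @ z = w[0 \<rightarrow> j]"
    using subsequence_append[of w i "j - i"] by simp
  then show thesis using that[of "w[0 \<rightarrow> i]"] initial_prefix[of w j] by simp
qed

lemma converges_to_initial:
  assumes "converges_to s w" and ext: "\<And>n. n \<ge> m \<Longrightarrow> \<exists>ys. s n = s m @ ys"
  shows "initial (s m) w"
  unfolding initial_def
proof (intro allI impI)
  fix i assume i: "i < length (s m)"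
  have "\<forall>\<^sub>F n in sequentially. (i < length (s n) \<and> s n ! i = w i) \<and> n \<ge> m"
    using assms(1) eventually_ge_at_top[of m] unfolding converges_to_def
    by (simp add: eventually_conj_iff)
  then obtain n where n: "s n ! i = w i" "n \<ge> m"
    unfolding eventually_sequentially by blast
  then show "s m ! i = w i" using ext[OF n(2)] i by (auto simp: nth_append)
qed

text \<open>Convergence is only letterwise, but \<open>z\<close> has finitely many positions, so a
  single index \<open>n\<close> serves them all.\<close>

lemma converges_to_initial_imp_append:
  assumes "converges_to s w" "initial z w"
  obtains n ys where "s n = z @ ys"
proof -
  have "\<forall>\<^sub>F n in sequentially. \<forall>i\<in>{..<length z}. i < length (s n) \<and> s n ! i = w i"
    using assms(1) unfolding converges_to_def by (intro eventually_ball_finite) auto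
  then obtain n where n: "\<And>i. i < length z \<Longrightarrow> i < length (s n) \<and> s n ! i = w i"
    unfolding eventually_sequentially by blast
  have "length z \<le> length (s n)" using n[of "length z - 1"] by (cases z) auto
  then have "take (length z) (s n) = z"
    using n assms(2) by (intro nth_equalityI) (auto simp: initial_def)
  then show thesis using that[of n "drop (length z) (s n)"] append_take_drop_id[of "length z" "s n"]
    by simp
qed

section \<open>Images of prefixes under morphisms\<close>

lemma prolongable_funpow_append:
  assumes "prolongable \<phi> a" "m \<le> n"
  shows "\<exists>ys. (extend \<phi> ^^ n) [a] = (extend \<phi> ^^ m) [a] @ ys"
  using assms(2)
proof (induction n rule: dec_induct)
  case (step n)
  obtain x where "\<phi> a = a # x" using assms(1) unfolding prolongable_def by blast
  then have "(extend \<phi> ^^ Suc n) [a] = (extend \<phi> ^^ n) ([a] @ x)"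
    by (simp add: funpow_Suc_right extend_def del: funpow.simps)
  also have "\<dots> = (extend \<phi> ^^ n) [a] @ (extend \<phi> ^^ n) x"
    by (rule extend_funpow_append)
  finally show ?case using step.IH by auto
qed simp

text \<open>This is the fixed-point property of the limit word, read on prefixes: \<open>z\<close>
  begins some \<open>\<phi>^m(a)\<close>, so its image under \<open>\<phi>^n\<close> begins
  \<open>\<phi>^(n+m)(a)\<close>, itself a prefix of the limit.\<close>

lemma pure_morphic_word_initial:
  assumes "prolongable \<phi> a" "initial z (pure_morphic_word \<phi> a)"
  shows "initial ((extend \<phi> ^^ n) z) (pure_morphic_word \<phi> a)"
proof -
  note conv = pure_morphic_word_limit[OF assms(1)]
  obtain m ys where "(extend \<phi> ^^ m) [a] = z @ ys"
    using converges_to_initial_imp_append[OF conv assms(2)] by blast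
  then have "(extend \<phi> ^^ (n + m)) [a] = (extend \<phi> ^^ n) z @ (extend \<phi> ^^ n) ys"
    by (simp add: funpow_add extend_funpow_append)
  moreover have "initial ((extend \<phi> ^^ (n + m)) [a]) (pure_morphic_word \<phi> a)"
    by (rule converges_to_initial[OF conv prolongable_funpow_append[OF assms(1)]])
  ultimately show ?thesis by (simp only: initial_appendD)
qed

lemma extend_infinite_initial:
  assumes "non_erasing g" "initial z w"
  shows "initial (extend g z) (extend_infinite g w)"
proof -
  have "\<exists>ys. extend g (w[0 \<rightarrow> n]) = extend g (w[0 \<rightarrow> m]) @ ys" if "m \<le> n" for m n
  proof -
    have "w[0 \<rightarrow> n] = w[0 \<rightarrow> m] @ w[m \<rightarrow> n]"
      using that subsequence_append[of w m "n - m"] by simp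
    then show ?thesis by (simp add: extend_append)
  qed
  then have "initial (extend g (w[0 \<rightarrow> length z])) (extend_infinite g w)"
    by (rule converges_to_initial[OF extend_infinite_limit[OF assms(1)]])
  then show ?thesis using initial_eq_prefix[OF assms(2)] by simp
qed

lemma length_extend_ge:
  assumes "non_erasing g"
  shows "length z \<le> length (extend g z)"
proof (induction z)
  case (Cons c z)
  have "g c \<noteq> []" using assms by (simp add: non_erasing_def)
  then have "1 \<le> length (g c)" by (cases "g c") auto
  then show ?case using Cons by (simp add: extend_def)
qed simp

text \<open>Transfers the bound on the digits in each \<open>g c\<close> to the whole image word, as
  \<open>base_expansion\<close> requires.\<close>

lemma extend_infinite_letter:
  assumes "non_erasing g"
  shows "\<exists>c. extend_infinite g w i \<in> set (g c)"
proof -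
  let ?z = "w[0 \<rightarrow> Suc i]"
  have "i < length (extend g ?z)" using length_extend_ge[OF assms, of ?z] by simp
  moreover from this have "extend g ?z ! i = extend_infinite g w i"
    using extend_infinite_initial[OF assms initial_prefix] unfolding initial_def by blast
  ultimately have "extend_infinite g w i \<in> set (extend g ?z)"
    using nth_mem[of i "extend g ?z"] by (simp only:)
  then show ?thesis by (auto simp: extend_def)
qed

text \<open>The block \<open>U @ Y @ U\<close> occurs right after \<open>R\<close> and again,
  overlapping itself, \<open>length (U @ Y)\<close> positions later; its length is the bound on
  \<open>j\<close>.\<close>

lemma initial_repetition_nth:
  assumes v: "initial (R @ U @ Y @ U @ Y @ U) v"
    and j: "j < length (U @ Y) + length U"
  shows "v (length R + j + length (U @ Y)) = v (length R + j)"
proof -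
  let ?B = "U @ Y @ U"
  let ?z = "R @ U @ Y @ U @ Y @ U"
  have "v (length R + j + length (U @ Y)) = ?z ! (length R + j + length (U @ Y))"
    using v j by (simp add: initial_def)
  also have "\<dots> = ((R @ U @ Y) @ ?B) ! (length (R @ U @ Y) + j)"
    by (simp add: algebra_simps)
  also have "\<dots> = ?B ! j" by (rule nth_append_length_plus)
  also have "\<dots> = (?B @ Y @ U) ! j"
    using j by (subst nth_append_left) auto
  also have "\<dots> = ?z ! (length R + j)"
    by (simp only: append_assoc nth_append_length_plus)
  also have "\<dots> = v (length R + j)"
    using v[unfolded initial_def, rule_format, of "length R + j"] j by simp
  finally show ?thesis .
qed

section \<open>Repetitions in base-p expansions\<close>

locale base_expansion =
  fixes p :: nat and v :: "nat word"
  assumes base_ge_2: "2 \<le> p" and digit_less: "v n < p"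
begin

text \<open>The expansion with all digits \<open>p - 1\<close> is a geometric series; as a majorant
  it yields both convergence and the upper bound 1.\<close>

lemma maximal_digits_sums: "(\<lambda>n. (real p - 1) / real p ^ Suc n) sums 1"
proof -
  have "(\<lambda>n. (real p - 1) / real p * (1 / real p) ^ n) sums
        ((real p - 1) / real p * (1 / (1 - 1 / real p)))"
    using base_ge_2 by (intro sums_mult geometric_sums) auto
  then show ?thesis using base_ge_2 by (simp add: field_simps)
qed

lemma digit_term_le: "real (v n) / real p ^ Suc n \<le> (real p - 1) / real p ^ Suc n"
proof -
  have "real (v n) \<le> real p - 1" using digit_less[of n] by linarith
  then show ?thesis by (rule divide_right_mono) simp
qed

lemma summable_digits: "summable (\<lambda>n. real (v n) / real p ^ Suc n)"
  by (rule summable_comparison_test'[OF sums_summable[OF maximal_digits_sums]])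
     (use digit_term_le in simp)

lemma base_value_nonneg: "0 \<le> base_value p v"
  unfolding base_value_def by (rule suminf_nonneg[OF summable_digits]) simp

lemma base_value_le_1: "base_value p v \<le> 1"
  unfolding base_value_def
  using suminf_le[OF digit_term_le summable_digits sums_summable[OF maximal_digits_sums]]
    sums_unique[OF maximal_digits_sums] by simp

lemma base_expansion_suffix: "base_expansion p (suffix k v)"
  using base_ge_2 digit_less by unfold_locales auto

lemma base_value_step: "real p * base_value p v = real (v 0) + base_value p (suffix 1 v)"
proof -
  interpret S: base_expansion p "suffix 1 v" by (rule base_expansion_suffix)
  have "base_value p v = real (v 0) / real p + (\<Sum>n. real (v (Suc n)) / real p ^ Suc (Suc n))"
    unfolding base_value_def using suminf_split_head[OF summable_digits] by simp
  also have "(\<Sum>n. real (v (Suc n)) / real p ^ Suc (Suc n)) = base_value p (suffix 1 v) / real p"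
    unfolding base_value_def using suminf_divide[OF S.summable_digits, of "real p"]
    by (simp add: field_simps)
  finally show ?thesis using base_ge_2 by (simp add: field_simps)
qed

lemma base_value_suffix_step:
  "real p * base_value p (suffix k v) = real (v k) + base_value p (suffix (Suc k) v)"
  using base_expansion.base_value_step[OF base_expansion_suffix, of k] by simp

text \<open>Multiplying by \<open>p^k\<close> moves the first \<open>k\<close> digits before the
  radix point; what remains is the value of the suffix.\<close>

lemma power_mult_base_value_Ints: "real p ^ k * base_value p v - base_value p (suffix k v) \<in> \<int>"
proof (induction k)
  case (Suc k)
  have "real p ^ Suc k * base_value p v - base_value p (suffix (Suc k) v) =
        real p * (real p ^ k * base_value p v - base_value p (suffix k v)) + real (v k)"
    using base_value_suffix_step[of k] by (simp add: algebra_simps)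
  then show ?case using Suc by (simp only: Ints_add Ints_mult Ints_of_nat)
qed simp

text \<open>Multiplying by \<open>p\<close> cancels a shared leading digit, so each such digit
  shrinks the distance by a factor \<open>p\<close>; after \<open>n\<close> of them both values
  still lie in [0,1]. Both positions advance, hence the induction over arbitrary \<open>m\<close>
  and \<open>k\<close>.\<close>

lemma dist_base_value_suffix_le:
  assumes "\<And>j. j < n \<Longrightarrow> v (m + j) = v (k + j)"
  shows "\<bar>base_value p (suffix m v) - base_value p (suffix k v)\<bar> \<le> 1 / real p ^ n"
  using assms
proof (induction n arbitrary: m k)
  case 0
  interpret M: base_expansion p "suffix m v" by (rule base_expansion_suffix)
  interpret K: base_expansion p "suffix k v" by (rule base_expansion_suffix)
  show ?case
    using M.base_value_nonneg M.base_value_le_1 K.base_value_nonneg K.base_value_le_1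
    unfolding power_0 by linarith
next
  case (Suc n)
  have "\<bar>base_value p (suffix (Suc m) v) - base_value p (suffix (Suc k) v)\<bar> \<le> 1 / real p ^ n"
    using Suc.prems[of "Suc _"] by (intro Suc.IH) simp
  moreover have "real p * (base_value p (suffix m v) - base_value p (suffix k v)) =
      base_value p (suffix (Suc m) v) - base_value p (suffix (Suc k) v)"
    using base_value_suffix_step[of m] base_value_suffix_step[of k] Suc.prems[of 0]
    by (simp add: algebra_simps)
  ultimately have "\<bar>real p * (base_value p (suffix m v) - base_value p (suffix k v))\<bar> \<le> 1 / real p ^ n"
    by (simp only:)
  then have "real p * \<bar>base_value p (suffix m v) - base_value p (suffix k v)\<bar> \<le> 1 / real p ^ n"
    by (simp only: abs_mult abs_of_nat)
  then show ?case using base_ge_2 by (simp add: field_simps del: suffix_nth)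
qed

lemma infdist_repetition_le:
  assumes "\<And>j. j < n \<Longrightarrow> v (r + j + s) = v (r + j)"
  shows "infdist (real (p ^ r * (p ^ s - 1)) * base_value p v) \<int> \<le> 1 / real p ^ n"
proof -
  let ?x = "base_value p v"
  let ?T = "\<lambda>k. base_value p (suffix k v)"
  \<comment> \<open>An integer close to the product: as
    \<open>p^r (p^s - 1) = p^(r+s) - p^r\<close>, subtracting it leaves just the difference of two
    suffix values.\<close>
  let ?z = "(real p ^ (r + s) * ?x - ?T (r + s)) - (real p ^ r * ?x - ?T r)"
  have "real (p ^ r * (p ^ s - 1)) = real p ^ r * (real p ^ s - 1)"
    using base_ge_2 by (simp add: of_nat_diff)
  then have "real (p ^ r * (p ^ s - 1)) * ?x - ?z = ?T (r + s) - ?T r"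
    by (simp only:) (simp add: algebra_simps power_add)
  then have "dist (real (p ^ r * (p ^ s - 1)) * ?x) ?z \<le> 1 / real p ^ n"
    using dist_base_value_suffix_le[of n "r + s" r] assms by (simp add: dist_real_def add_ac)
  moreover have "?z \<in> \<int>" by (rule Ints_diff[OF power_mult_base_value_Ints power_mult_base_value_Ints])
  ultimately show ?thesis by (rule infdist_le2[rotated])
qed

end

section \<open>A repetition criterion for pLC\<close>

lemma satisfies_pLC_I:
  assumes "\<And>e N. e > 0 \<Longrightarrow> \<exists>q\<ge>N. real q * padic_abs p q * infdist (real q * x) \<int> < e"
  shows "satisfies_pLC p x"
  unfolding satisfies_pLC_def
proof (rule antisym)
  let ?f = "\<lambda>q. real q * padic_abs p q * infdist (real q * x) \<int>"
  show "liminf (\<lambda>q. ereal (?f q)) \<le> 0"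
  proof (rule ccontr)
    assume "\<not> ?thesis"
    then obtain y where y: "0 < y" "y < liminf (\<lambda>q. ereal (?f q))"
      using dense[of 0 "liminf (\<lambda>q. ereal (?f q))"] by (auto simp only: not_le)
    then have "\<forall>\<^sub>F q in sequentially. y < ereal (?f q)"
      by (intro less_LiminfD)
    then obtain N where N: "\<And>q. q \<ge> N \<Longrightarrow> y < ereal (?f q)"
      unfolding eventually_sequentially by blast
    \<comment> \<open>The extended real \<open>y\<close> lies between 0 and the finite
      \<open>?f N\<close>, so it is real.\<close>
    obtain e where e: "y = ereal e" using y N[of N] by (cases y) auto
    obtain q where "q \<ge> N" "?f q < e" using assms[of e N] y(1) e by auto
    then show False using N[of q] e by simp
  qed
  show "0 \<le> liminf (\<lambda>q. ereal (?f q))"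
    by (intro Liminf_bounded always_eventually allI)
       (simp add: padic_abs_def infdist_nonneg)
qed

text \<open>The condition \<open>l \<le> s\<close> makes \<open>s\<close> grow with
  \<open>L\<close>, so that the multipliers \<open>p^r (p^s - 1)\<close> become arbitrarily
  large.\<close>

lemma (in base_expansion) satisfies_pLC_repetition:
  assumes rep: "\<And>L. \<exists>r s l. L \<le> l \<and> l \<le> s \<and> (\<forall>j<s + l. v (r + j + s) = v (r + j))"
  shows "satisfies_pLC p (base_value p v)"
proof (rule satisfies_pLC_I)
  fix e :: real and N :: nat
  assume "e > 0"
  obtain M where M: "(1 / real p) ^ M < e"
    using real_arch_pow_inv[OF \<open>e > 0\<close>, of "1 / real p"] base_ge_2 by auto
  \<comment> \<open>\<open>M\<close> makes \<open>p^(-l)\<close> smaller than \<open>e\<close>;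
    \<open>Suc N\<close> forces \<open>s > N\<close>, hence \<open>q \<ge> N\<close> and
    \<open>q > 0\<close>.\<close>
  obtain r s l where l: "max M (Suc N) \<le> l" "l \<le> s"
    and v: "\<And>j. j < s + l \<Longrightarrow> v (r + j + s) = v (r + j)"
    using rep[of "max M (Suc N)"] by blast
  define q where "q = p ^ r * (p ^ s - 1)"
  have "s < p ^ s" using base_ge_2 by (intro power_gt_expt) auto
  then have "N \<le> p ^ s - 1" "0 < p ^ s - 1" using l by auto
  moreover have "p ^ s - 1 \<le> q" using base_ge_2 by (simp add: q_def)
  ultimately have "N \<le> q" "0 < q" by linarith+
  \<comment> \<open>Divisibility by \<open>p ^ r\<close> bounds \<open>padic_abs p q\<close> from
    above, which is the direction required.\<close>
  have "r \<le> multiplicity p q"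
    using \<open>0 < q\<close> base_ge_2 by (intro multiplicity_geI) (auto simp: q_def)
  then have "padic_abs p q \<le> 1 / real p ^ r"
    using base_ge_2 \<open>0 < q\<close> by (auto simp: padic_abs_def intro!: divide_left_mono power_increasing)
  then have "real q * padic_abs p q \<le> real q * (1 / real p ^ r)"
    by (rule mult_left_mono) simp
  also have "\<dots> = real (p ^ s - 1)" using base_ge_2 by (simp add: q_def)
  also have "\<dots> \<le> real p ^ s" by (simp flip: of_nat_power)
  finally have "real q * padic_abs p q * infdist (real q * base_value p v) \<int>
      \<le> real p ^ s * (1 / real p ^ (s + l))"
    using infdist_repetition_le[OF v] unfolding q_def
    by (intro mult_mono) (auto simp: infdist_nonneg)
  also have "\<dots> = (1 / real p) ^ l" using base_ge_2 by (simp add: power_add power_divide)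
  also have "\<dots> \<le> (1 / real p) ^ M" using base_ge_2 l by (intro power_decreasing) auto
  also note M
  finally show "\<exists>q\<ge>N. real q * padic_abs p q * infdist (real q * base_value p v) \<int> < e"
    using \<open>N \<le> q\<close> by blast
qed

theorem proposition2p8:
  fixes p :: nat
    and \<phi> :: "'a :: finite \<Rightarrow> 'a list"
    and a u :: 'a
    and X :: "'a list"
    and w :: "'a word"
    and g :: "'a \<Rightarrow> nat list"
  assumes "prime p"
    and "prolongable \<phi> a"
    and "w = pure_morphic_word \<phi> a"
    and "subword ([u] @ X @ [u] @ X @ [u]) w"
    and "filterlim (\<lambda>n. length ((extend \<phi> ^^ n) [u])) at_top sequentially"
    and "non_erasing g"
    and "\<forall>c. set (g c) \<subseteq> {0..<p}"
  shows "satisfies_pLC p (base_value p (extend_infinite g w))"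
proof -
  let ?v = "extend_infinite g w"
  interpret base_expansion p ?v
  proof
    show "2 \<le> p" using \<open>prime p\<close> by (rule prime_ge_2_nat)
    show "?v n < p" for n
      using extend_infinite_letter[OF assms(6), of w n] assms(7) by fastforce
  qed
  obtain P where P: "initial (P @ [u] @ X @ [u] @ X @ [u]) w"
    using subword_initial[OF assms(4)] by blast
  show ?thesis
  proof (rule satisfies_pLC_repetition)
    fix L
    obtain n where n: "L \<le> length ((extend \<phi> ^^ n) [u])"
      using assms(5) unfolding filterlim_at_top eventually_sequentially by blast
    let ?h = "\<lambda>z. extend g ((extend \<phi> ^^ n) z)"
    have "initial (?h (P @ [u] @ X @ [u] @ X @ [u])) ?v"
      using pure_morphic_word_initial[OF assms(2), of _ n] P assms(3)
      by (intro extend_infinite_initial[OF assms(6)]) simp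
    then have v: "initial (?h P @ ?h [u] @ ?h X @ ?h [u] @ ?h X @ ?h [u]) ?v"
      by (simp only: extend_funpow_append extend_append)
    show "\<exists>r s l. L \<le> l \<and> l \<le> s \<and> (\<forall>j<s + l. ?v (r + j + s) = ?v (r + j))"
      \<comment> \<open>\<open>L \<le> l\<close> holds because a non-erasing \<open>g\<close> never
        shortens a word, and \<open>l \<le> s\<close> because \<open>?h [u]\<close> is part of the
        period.\<close>
      using n length_extend_ge[OF assms(6), of "(extend \<phi> ^^ n) [u]"] initial_repetition_nth[OF v]
      by (intro exI[of _ "length (?h P)"] exI[of _ "length (?h [u] @ ?h X)"]
          exI[of _ "length (?h [u])"]) auto
  qed
qed

end
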